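(* Let $p\in\{1,2\}$, and assume that, for every $d_x\in\mathbb N$, the link function $\ell^{\,d_x}$ is Bochner $p$-integrable. Suppose further that there exists a polynomial $P_{n,p}(d_x)$ of degree $n$ such that $$K_p^{d_x}\le P_{n,p}(d_x),\qquad \forall d_x\in\mathbb N.$$ Then there is a constant $B_p<\infty$ depending only on $p$ such that, for every $d_x\in\mathbb N$, every $f\in B(\mathcal X)$ and every $N\in\mathbb N$, $$\|\pi_Y(f)-\pi_Y^N(f)\|_p\le\frac{B_p\,P_{n,p}(d_x)\,\|f\|_\infty}{\sqrt N}.$$
   Context: A family of models indexed by $d_x\in\mathbb N$ is given, with $d_y$ fixed. For each $d_x$: $\mathcal X\subseteq\mathbb R^{d_x}$ and $\mathcal Y\subseteq\mathbb R^{d_y}$ are Borel sets; $\pi_0$ is a probability measure on $\mathcal X$ ($\mathcal X$ and $\pi_0$ depend on $d_x$). Given $X=x$, the observation $Y$ has density $g(y\mid x)$ w.r.t. Lebesgue measure on $\mathcal Y$. We write $g_y^{d_x}(x):=g(y\mid x)$; $g$ is jointly measurable, $g_y^{d_x}(x)>0$ for all $(x,y)$, $\int_{\mathcal Y}g_y^{d_x}(x)\,\mathrm dy=1$ for all $x$, and $g_y^{d_x}\in L^2(\pi_0)$ for all $y$. For a measure $\mu$ and function $h$, $\mu(h):=\int h\,\mathrm d\mu$. The marginal law of $Y$ is $\eta(\mathrm dy):=\pi_0(g_y^{d_x})\,\mathrm dy$. The posterior given $y$ is $\pi_y(\mathrm dx):=g_y^{d_x}(x)\pi_0(\mathrm dx)/\pi_0(g_y^{d_x})$.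 Importance sampler: $x^1,\dots,x^N$ are i.i.d. from $\pi_0$, with weights $w^i=g_y^{d_x}(x^i)/\sum_{j=1}^N g_y^{d_x}(x^j)$, and $\pi_y^N:=\sum_{i=1}^N w^i\delta_{x^i}$. $\pi_Y$ and $\pi_Y^N$ denote these objects evaluated at a random observation $Y\sim\eta$, with $Y$ independent of the samples. $\|\pi_Y(f)-\pi_Y^N(f)\|_p:=\mathbb E[|\pi_Y(f)-\pi_Y^N(f)|^p]^{1/p}$, the expectation being over the joint law of $Y$ and the samples. $B(\mathcal X)$ is the set of bounded measurable functions $f:\mathcal X\to\mathbb R$, with $\|f\|_\infty=\sup|f|$. Link function: $\ell^{\,d_x}:\mathcal Y\to L^2(\pi_0)$, $\ell_y^{\,d_x}:=g_y^{d_x}(\cdot)/\pi_0(g_y^{d_x})$. It is Bochner $p$-integrable iff it is strongly $\eta$-measurable and $K_p^{d_x}:=\int_{\mathcal Y}\|\ell_y^{\,d_x}\|_{L^2(\pi_0)}^p\,\eta(\mathrm dy)<\infty$. *)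

theory Defs
  imports "HOL-Probability.Probability" "HOL-Computational_Algebra.Polynomial"
begin

text \<open>
  The dimension varies inside a single statement, so \<open>\<real>\<^sup>d\<close> is the space of extensional functions
  on \<open>{..<d}\<close>. The measure below is Lebesgue measure on \<open>\<real>\<^sup>d\<close>, and its measurable sets are the
  Borel sets of \<open>\<real>\<^sup>d\<close>.
\<close>

definition leb :: "nat \<Rightarrow> (nat \<Rightarrow> real) measure" where
  "leb d = Pi\<^sub>M {..<d} (\<lambda>_. lborel)"

locale bayes_model =
  fixes dx dy :: nat
    and X Y :: "(nat \<Rightarrow> real) set"
    and \<pi>0 :: "(nat \<Rightarrow> real) measure"
    and g :: "(nat \<Rightarrow> real) \<Rightarrow> (nat \<Rightarrow> real) \<Rightarrow> real"  \<comment> \<open>\<open>g y x\<close> is the density of \<open>y\<close> given \<open>x\<close>\<close>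
  assumes X_borel: "X \<in> sets (leb dx)"
    and Y_borel: "Y \<in> sets (leb dy)"
    and prior_prob: "prob_space \<pi>0"
    and prior_sets: "sets \<pi>0 = sets (restrict_space (leb dx) X)"
    and g_measurable:
      "(\<lambda>(y, x). g y x) \<in> borel_measurable (restrict_space (leb dy) Y \<Otimes>\<^sub>M \<pi>0)"
    and g_pos: "\<And>x y. x \<in> X \<Longrightarrow> y \<in> Y \<Longrightarrow> g y x > 0"
    \<comment> \<open>value 1 forces integrability: the Bochner integral of a non-integrable function is 0\<close>
    and g_density: "\<And>x. x \<in> X \<Longrightarrow> (\<integral>y. g y x \<partial>restrict_space (leb dy) Y) = 1"
    and g_L2: "\<And>y. y \<in> Y \<Longrightarrow> integrable \<pi>0 (\<lambda>x. (g y x)\<^sup>2)"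

definition evidence ::
  "'x measure \<Rightarrow> ('y \<Rightarrow> 'x \<Rightarrow> real) \<Rightarrow> 'y \<Rightarrow> real" where
  "evidence \<pi>0 g y = (\<integral>x. g y x \<partial>\<pi>0)"

definition marginal ::
  "nat \<Rightarrow> (nat \<Rightarrow> real) set \<Rightarrow> 'x measure \<Rightarrow> ((nat \<Rightarrow> real) \<Rightarrow> 'x \<Rightarrow> real)
    \<Rightarrow> (nat \<Rightarrow> real) measure" where
  "marginal dy Y \<pi>0 g = density (restrict_space (leb dy) Y) (\<lambda>y. ennreal (evidence \<pi>0 g y))"

definition posterior ::
  "'x measure \<Rightarrow> ('y \<Rightarrow> 'x \<Rightarrow> real) \<Rightarrow> 'y \<Rightarrow> 'x measure" where
  "posterior \<pi>0 g y = density \<pi>0 (\<lambda>x. ennreal (g y x / evidence \<pi>0 g y))"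

definition weight ::
  "('y \<Rightarrow> 'x \<Rightarrow> real) \<Rightarrow> nat \<Rightarrow> 'y \<Rightarrow> (nat \<Rightarrow> 'x) \<Rightarrow> nat \<Rightarrow> real" where
  "weight g N y xs i = g y (xs i) / (\<Sum>j<N. g y (xs j))"

text \<open>
  The weighted empirical measure \<open>\<Sum>i<N. w\<^sub>i \<delta>(xs i)\<close>, written as the push-forward along the sample
  of the measure with masses \<open>w\<^sub>i\<close> on the indices, so that coinciding sample points add up.
\<close>

definition importance_measure ::
  "'x measure \<Rightarrow> ('y \<Rightarrow> 'x \<Rightarrow> real) \<Rightarrow> nat \<Rightarrow> 'y \<Rightarrow> (nat \<Rightarrow> 'x) \<Rightarrow> 'x measure" where
  "importance_measure \<pi>0 g N y xs =
     distr (point_measure {..<N} (\<lambda>i. ennreal (weight g N y xs i))) \<pi>0 xs"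

lemma emeasure_importance_measure:
  assumes "xs \<in> {..<N} \<rightarrow> space \<pi>0" and "A \<in> sets \<pi>0"
  shows "emeasure (importance_measure \<pi>0 g N y xs) A =
    (\<Sum>i<N. ennreal (weight g N y xs i) * indicator A (xs i))"
proof -
  have m: "xs \<in> measurable (point_measure {..<N} (\<lambda>i. ennreal (weight g N y xs i))) \<pi>0"
    using assms(1) by (simp add: point_measure_def measurable_def space_density)
  have "emeasure (importance_measure \<pi>0 g N y xs) A =
      (\<Sum>i\<in>xs -` A \<inter> {..<N}. ennreal (weight g N y xs i))"
    unfolding importance_measure_def
    by (subst emeasure_distr[OF m assms(2)])
       (auto simp: space_point_measure intro!: emeasure_point_measure_finite)
  also have "\<dots> = (\<Sum>i<N. ennreal (weight g N y xs i) * indicator A (xs i))"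
    by (rule sum.mono_neutral_cong_left) (auto simp: indicator_def)
  finally show ?thesis .
qed

text \<open>
  \<open>\<parallel>\<pi>\<^sub>Y(f) - \<pi>\<^sub>Y\<^sup>N(f)\<parallel>\<^sub>p\<close>; the product measure is the joint law of the observation and the
  independent i.i.d. prior samples.
\<close>

definition Lp_error ::
  "nat \<Rightarrow> nat \<Rightarrow> (nat \<Rightarrow> real) set \<Rightarrow> 'x measure \<Rightarrow> ((nat \<Rightarrow> real) \<Rightarrow> 'x \<Rightarrow> real)
    \<Rightarrow> nat \<Rightarrow> ('x \<Rightarrow> real) \<Rightarrow> real" where
  "Lp_error p dy Y \<pi>0 g N f =
     (\<integral>(y, xs). \<bar>(\<integral>x. f x \<partial>posterior \<pi>0 g y) - (\<integral>x. f x \<partial>importance_measure \<pi>0 g N y xs)\<bar> ^ p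
        \<partial>(marginal dy Y \<pi>0 g \<Otimes>\<^sub>M Pi\<^sub>M {..<N} (\<lambda>_. \<pi>0))) powr (1 / real p)"

definition bounded_measurable :: "'x measure \<Rightarrow> ('x \<Rightarrow> real) set" where
  "bounded_measurable M = {f \<in> borel_measurable M. bounded (f ` space M)}"

definition sup_norm :: "'x set \<Rightarrow> ('x \<Rightarrow> real) \<Rightarrow> real" where
  "sup_norm X f = (SUP x\<in>X. \<bar>f x\<bar>)"

text \<open>
  Elements of \<open>L\<^sup>2\<close> are represented by functions; equality almost everywhere is only seen through
  the seminorm.
\<close>

definition L2_fun :: "'x measure \<Rightarrow> ('x \<Rightarrow> real) set" where
  "L2_fun M = {u \<in> borel_measurable M. integrable M (\<lambda>x. (u x)\<^sup>2)}"

definition L2_norm :: "'x measure \<Rightarrow> ('x \<Rightarrow> real) \<Rightarrow> real" where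
  "L2_norm M u = sqrt (\<integral>x. (u x)\<^sup>2 \<partial>M)"

text \<open>
  Strong (Bochner) measurability of an \<open>L\<^sup>2(M)\<close>-valued map: almost everywhere limit, in \<open>L\<^sup>2(M)\<close>,
  of simple functions with values in \<open>L\<^sup>2(M)\<close>.
\<close>

definition strongly_measurable_L2 ::
  "'y measure \<Rightarrow> 'x measure \<Rightarrow> ('y \<Rightarrow> 'x \<Rightarrow> real) \<Rightarrow> bool" where
  "strongly_measurable_L2 \<eta> M h \<longleftrightarrow>
     h \<in> space \<eta> \<rightarrow> L2_fun M \<and>
     (\<exists>s. (\<forall>k. simple_function \<eta> (s k) \<and> s k \<in> space \<eta> \<rightarrow> L2_fun M) \<and>
          (AE y in \<eta>. (\<lambda>k. L2_norm M (\<lambda>x. s k y x - h y x)) \<longlonglongrightarrow> 0))"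

definition link :: "'x measure \<Rightarrow> ('y \<Rightarrow> 'x \<Rightarrow> real) \<Rightarrow> 'y \<Rightarrow> 'x \<Rightarrow> real" where
  "link \<pi>0 g y x = g y x / evidence \<pi>0 g y"

definition K ::
  "nat \<Rightarrow> nat \<Rightarrow> (nat \<Rightarrow> real) set \<Rightarrow> 'x measure \<Rightarrow> ((nat \<Rightarrow> real) \<Rightarrow> 'x \<Rightarrow> real) \<Rightarrow> ennreal" where
  "K p dy Y \<pi>0 g = (\<integral>\<^sup>+y. ennreal (L2_norm \<pi>0 (link \<pi>0 g y) ^ p) \<partial>marginal dy Y \<pi>0 g)"

definition link_Bochner_integrable ::
  "nat \<Rightarrow> nat \<Rightarrow> (nat \<Rightarrow> real) set \<Rightarrow> 'x measure \<Rightarrow> ((nat \<Rightarrow> real) \<Rightarrow> 'x \<Rightarrow> real) \<Rightarrow> bool" where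
  "link_Bochner_integrable p dy Y \<pi>0 g \<longleftrightarrow>
     strongly_measurable_L2 (marginal dy Y \<pi>0 g) \<pi>0 (link \<pi>0 g) \<and> K p dy Y \<pi>0 g < \<infinity>"

end

theory Submission
  imports Defs
begin

text \<open>
  Fix \<open>y\<close>, write \<open>l\<close> for the link function, \<open>b = \<pi>\<^sub>y(f) = \<pi>\<^sub>0(l f)\<close> and \<open>q = \<pi>\<^sub>y\<^sup>N(f)\<close>. Since
  the weights are scale invariant, \<open>q \<Sum>\<^sub>i l(x\<^sub>i) = \<Sum>\<^sub>i l(x\<^sub>i) f(x\<^sub>i)\<close>, hence
  \<open>N (b - q) = q \<Sum>\<^sub>i (l(x\<^sub>i) - 1) - \<Sum>\<^sub>i (l(x\<^sub>i) f(x\<^sub>i) - b)\<close>. Both sums consist of centred i.i.d. terms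
  with second moments at most \<open>\<parallel>l\<parallel>\<^sup>2\<close> and \<open>\<parallel>f\<parallel>\<^sub>\<infinity>\<^sup>2 \<parallel>l\<parallel>\<^sup>2\<close>, and \<open>\<bar>q\<bar> \<le> \<parallel>f\<parallel>\<^sub>\<infinity>\<close>, so the conditional
  \<open>L\<^sup>2\<close> error is at most \<open>2 \<parallel>f\<parallel>\<^sub>\<infinity> \<parallel>l\<parallel> / sqrt N\<close>, and by Jensen so is the \<open>L\<^sup>1\<close> error. Integrating the
  \<open>p\<close>-th power over \<open>y\<close> gives the bound with \<open>K\<^sub>p\<close> to the power \<open>1 / p\<close>; this exponent can be dropped
  because \<open>\<parallel>l\<parallel> \<ge> \<pi>\<^sub>0(l) = 1\<close> forces \<open>K\<^sub>p \<ge> 1\<close>. Thus \<open>B = 2\<close> works for both \<open>p\<close>.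
\<close>

section \<open>Second moments of sums of centred i.i.d. variables\<close>

lemma (in prob_space) PiM_sum_square:
  fixes h :: "'a \<Rightarrow> real"
  assumes h: "integrable M h" and h2: "integrable M (\<lambda>x. (h x)\<^sup>2)"
    and mean: "expectation h = 0"
  shows "integrable (Pi\<^sub>M {..<N::nat} (\<lambda>_. M)) (\<lambda>xs. (\<Sum>i<N. h (xs i))\<^sup>2)"
    and "(\<integral>xs. (\<Sum>i<N. h (xs i))\<^sup>2 \<partial>Pi\<^sub>M {..<N} (\<lambda>_. M)) = real N * (\<integral>x. (h x)\<^sup>2 \<partial>M)"
proof -
  let ?P = "Pi\<^sub>M {..<N} (\<lambda>_. M)"
  interpret P: product_sigma_finite "\<lambda>_::nat. M" ..
  have [measurable]: "h \<in> borel_measurable M"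
    using h by auto
  have diag: "integrable ?P (\<lambda>xs. h (xs i) * h (xs i)) \<and>
      (\<integral>xs. h (xs i) * h (xs i) \<partial>?P) = (\<integral>x. (h x)\<^sup>2 \<partial>M)" if "i < N" for i
  proof -
    have comp: "(\<lambda>xs. xs i) \<in> measurable ?P M"
      using that by (intro measurable_component_singleton) auto
    have distr: "distr ?P M (\<lambda>xs. xs i) = M"
      using that by (intro distr_PiM_component prob_space_axioms) auto
    have m: "(\<lambda>x. (h x)\<^sup>2) \<in> borel_measurable M"
      by simp
    show ?thesis
      using integrable_distr_eq[OF comp m] integral_distr[OF comp m] h2
      by (simp add: distr power2_eq_square)
  qed
  \<comment> \<open>By independence the mixed products have mean zero, so only the \<open>N\<close>
    diagonal terms survive when the square is expanded.\<close>
  have off: "integrable ?P (\<lambda>xs. h (xs i) * h (xs j)) \<and>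
      (\<integral>xs. h (xs i) * h (xs j) \<partial>?P) = 0" if "i < N" "j < N" "i \<noteq> j" for i j
  proof -
    define F where "F k = (if k = i \<or> k = j then h else (\<lambda>_. 1))" for k
    have F: "integrable M (F k)" for k
      using h by (simp add: F_def)
    have split: "(\<Prod>k<N. F k (xs k)) = h (xs i) * h (xs j)" for xs
    proof -
      have "(\<Prod>k<N. F k (xs k)) = (\<Prod>k\<in>{i, j}. F k (xs k))"
        using that by (intro prod.mono_neutral_right) (auto simp: F_def)
      then show ?thesis
        using that by (simp add: F_def)
    qed
    have "(\<Prod>k<N. integral\<^sup>L M (F k)) = 0"
      using that mean by (auto simp: F_def intro!: bexI[of _ i])
    then show ?thesis
      using P.product_integrable_prod[of "{..<N}" F] P.product_integral_prod[of "{..<N}" F] F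
      by (simp add: split)
  qed
  have int: "integrable ?P (\<lambda>xs. h (xs i) * h (xs j))" if "i < N" "j < N" for i j
    using diag[of i] off[of i j] that by (cases "i = j") auto
  have eq: "(\<Sum>i<N. h (xs i))\<^sup>2 = (\<Sum>i<N. \<Sum>j<N. h (xs i) * h (xs j))" for xs
    by (simp add: power2_eq_square sum_product)
  show "integrable ?P (\<lambda>xs. (\<Sum>i<N. h (xs i))\<^sup>2)"
    unfolding eq by (intro Bochner_Integration.integrable_sum int) auto
  have "(\<integral>xs. (\<Sum>i<N. h (xs i))\<^sup>2 \<partial>?P) =
      (\<Sum>i<N. \<Sum>j<N. \<integral>xs. h (xs i) * h (xs j) \<partial>?P)"
    unfolding eq
    by (subst Bochner_Integration.integral_sum)
       (auto intro!: sum.cong Bochner_Integration.integral_sum Bochner_Integration.integrable_sum int)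
  also have "\<dots> = (\<Sum>i<N. \<Sum>j<N. if j = i then (\<integral>x. (h x)\<^sup>2 \<partial>M) else 0)"
    using diag off by (intro sum.cong refl) auto
  also have "\<dots> = real N * (\<integral>x. (h x)\<^sup>2 \<partial>M)"
    by simp
  finally show "(\<integral>xs. (\<Sum>i<N. h (xs i))\<^sup>2 \<partial>?P) = real N * (\<integral>x. (h x)\<^sup>2 \<partial>M)" .
qed

text \<open>The variance is the second moment minus the squared mean.\<close>

lemma (in prob_space) integral_centred_square_le:
  fixes h :: "'a \<Rightarrow> real"
  assumes "integrable M h" and "integrable M (\<lambda>x. (h x)\<^sup>2)"
  shows "integrable M (\<lambda>x. (h x - expectation h)\<^sup>2)"
    and "(\<integral>x. (h x - expectation h)\<^sup>2 \<partial>M) \<le> (\<integral>x. (h x)\<^sup>2 \<partial>M)"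
  using assms variance_eq[of h] by (auto simp: power2_diff)

section \<open>The self-normalised estimator for a fixed observation\<close>

lemma self_normalised_error_le:
  fixes l f :: "nat \<Rightarrow> real"
  assumes pos: "\<And>i. i < N \<Longrightarrow> l i > 0" and f: "\<And>i. i < N \<Longrightarrow> \<bar>f i\<bar> \<le> S" and N: "N \<ge> 1"
  shows "(b - (\<Sum>i<N. l i / (\<Sum>j<N. l j) * f i))\<^sup>2
    \<le> (2 * (\<Sum>i<N. l i * f i - b)\<^sup>2 + 2 * S\<^sup>2 * (\<Sum>i<N. l i - 1)\<^sup>2) / (real N)\<^sup>2"
proof -
  define T where "T = (\<Sum>j<N. l j)"
  define q where "q = (\<Sum>i<N. l i / T * f i)"
  have T: "T > 0"
    unfolding T_def using pos N by (intro sum_pos) (auto simp: lessThan_empty_iff)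
  \<comment> \<open>The weights \<open>l i / T\<close> are positive with sum 1, so \<open>q\<close>
    is an average of the \<open>f i\<close>.\<close>
  have "\<bar>q\<bar> \<le> (\<Sum>i<N. \<bar>l i / T * f i\<bar>)"
    unfolding q_def by (rule sum_abs)
  also have "\<dots> \<le> (\<Sum>i<N. l i / T * S)"
    using pos f T
    by (intro sum_mono) (auto simp: abs_mult less_imp_le intro!: divide_right_mono mult_left_mono)
  also have "\<dots> = S"
    using T by (simp add: sum_distrib_right[symmetric] sum_divide_distrib[symmetric] T_def)
  finally have q: "q\<^sup>2 \<le> S\<^sup>2"
    by (metis abs_ge_zero power2_abs power_mono)
  have qT: "q * T = (\<Sum>i<N. l i * f i)"
    using T by (simp add: q_def sum_distrib_right)
  define U where "U = (\<Sum>i<N. l i * f i - b)"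
  define V where "V = (\<Sum>i<N. l i - 1)"
  \<comment> \<open>The two occurrences of \<open>q * T\<close> cancel, so the random denominator
    drops out.\<close>
  have "real N * (b - q) = q * V - U"
    unfolding U_def V_def sum_subtractf qT[symmetric] T_def[symmetric] by (simp add: algebra_simps)
  then have "(real N)\<^sup>2 * (b - q)\<^sup>2 = (q * V - U)\<^sup>2"
    by (metis power_mult_distrib)
  \<comment> \<open>The right side exceeds the left by exactly
    \<open>(q * V + U)\<^sup>2\<close>.\<close>
  also have "\<dots> \<le> 2 * U\<^sup>2 + 2 * (q\<^sup>2 * V\<^sup>2)"
    using zero_le_power2[of "q * V + U"] by (simp add: power2_eq_square algebra_simps)
  also have "\<dots> \<le> 2 * U\<^sup>2 + 2 * S\<^sup>2 * V\<^sup>2"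
    using mult_right_mono[OF q, of "V\<^sup>2"] by simp
  finally show ?thesis
    using N by (simp add: field_simps U_def V_def q_def T_def)
qed

text \<open>Integrates the pathwise bound of \<open>self_normalised_error_le\<close>. Each of its
  two sums contributes at most \<open>2 * S\<^sup>2 * L / real N\<close>, whence the factor
  4.\<close>

lemma (in prob_space) importance_sampling_mean_square_error:
  fixes l f :: "'a \<Rightarrow> real"
  assumes [measurable]: "l \<in> borel_measurable M" "f \<in> borel_measurable M"
    and l2: "integrable M (\<lambda>x. (l x)\<^sup>2)" and mean: "expectation l = 1"
    and pos: "\<And>x. x \<in> space M \<Longrightarrow> l x > 0"
    and f: "\<And>x. x \<in> space M \<Longrightarrow> \<bar>f x\<bar> \<le> S" and N: "N \<ge> 1"
  shows "(\<integral>\<^sup>+xs. ennreal (((\<integral>x. l x * f x \<partial>M) -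
      (\<Sum>i<N. l (xs i) / (\<Sum>j<N. l (xs j)) * f (xs i)))\<^sup>2) \<partial>Pi\<^sub>M {..<N} (\<lambda>_. M))
    \<le> ennreal (4 * S\<^sup>2 * (\<integral>x. (l x)\<^sup>2 \<partial>M) / real N)"
proof -
  let ?P = "Pi\<^sub>M {..<N} (\<lambda>_. M)"
  define b where "b = (\<integral>x. l x * f x \<partial>M)"
  define L where "L = (\<integral>x. (l x)\<^sup>2 \<partial>M)"
  have lf_sq: "(l x * f x)\<^sup>2 \<le> S\<^sup>2 * (l x)\<^sup>2" if "x \<in> space M" for x
    using power_mono[OF f[OF that], of 2]
    by (simp add: power_mult_distrib mult.commute mult_right_mono)
  have lf2: "integrable M (\<lambda>x. (l x * f x)\<^sup>2)"
    by (rule Bochner_Integration.integrable_bound[OF integrable_mult_right[OF l2, of "S\<^sup>2"]])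
       (use lf_sq in auto)
  have lf: "integrable M (\<lambda>x. l x * f x)" and l: "integrable M l"
    using lf2 l2 by (auto intro!: square_integrable_imp_integrable)
  have "(\<integral>x. (l x * f x)\<^sup>2 \<partial>M) \<le> (\<integral>x. S\<^sup>2 * (l x)\<^sup>2 \<partial>M)"
    using lf2 l2 lf_sq by (intro integral_mono) auto
  then have lf_le: "(\<integral>x. (l x * f x)\<^sup>2 \<partial>M) \<le> S\<^sup>2 * L"
    by (simp add: L_def)
  note cU = integral_centred_square_le[OF lf lf2, folded b_def]
  note cV = integral_centred_square_le[OF l l2, unfolded mean]
  have mU: "integrable M (\<lambda>x. l x * f x - b)" "expectation (\<lambda>x. l x * f x - b) = 0"
    using lf by (auto simp: b_def prob_space)
  have mV: "integrable M (\<lambda>x. l x - 1)" "expectation (\<lambda>x. l x - 1) = 0"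
    using l by (auto simp: mean prob_space)
  \<comment> \<open>\<open>E\<close> majorises the squared error pointwise and, unlike that ratio of
    sums, has an integral given by second moments.\<close>
  define E where "E xs = (2 * (\<Sum>i<N. l (xs i) * f (xs i) - b)\<^sup>2
      + 2 * S\<^sup>2 * (\<Sum>i<N. l (xs i) - 1)\<^sup>2) / (real N)\<^sup>2" for xs
  note sU = PiM_sum_square[OF mU(1) cU(1) mU(2), of N]
  note sV = PiM_sum_square[OF mV(1) cV(1) mV(2), of N]
  have E: "integrable ?P E"
    unfolding E_def using sU(1) sV(1) by auto
  have "integral\<^sup>L ?P E = (2 * (real N * (\<integral>x. (l x * f x - b)\<^sup>2 \<partial>M))
      + 2 * S\<^sup>2 * (real N * (\<integral>x. (l x - 1)\<^sup>2 \<partial>M))) / (real N)\<^sup>2"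
    unfolding E_def using sU sV by simp
  also have "\<dots> \<le> (2 * (real N * (S\<^sup>2 * L)) + 2 * S\<^sup>2 * (real N * L)) / (real N)\<^sup>2"
    using cU(2) cV(2) lf_le
    by (intro divide_right_mono add_mono mult_left_mono) (auto simp: L_def)
  also have "\<dots> = 4 * S\<^sup>2 * L / real N"
    using N by (simp add: field_simps power2_eq_square)
  finally have bound: "integral\<^sup>L ?P E \<le> 4 * S\<^sup>2 * L / real N" .
  have "(\<integral>\<^sup>+xs. ennreal ((b - (\<Sum>i<N. l (xs i) / (\<Sum>j<N. l (xs j)) * f (xs i)))\<^sup>2) \<partial>?P)
      \<le> (\<integral>\<^sup>+xs. ennreal (E xs) \<partial>?P)"
  proof (intro nn_integral_mono ennreal_leI)
    fix xs assume "xs \<in> space ?P"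
    then have "xs i \<in> space M" if "i < N" for i
      using that by (auto simp: space_PiM)
    then show "(b - (\<Sum>i<N. l (xs i) / (\<Sum>j<N. l (xs j)) * f (xs i)))\<^sup>2 \<le> E xs"
      unfolding E_def using pos f N by (intro self_normalised_error_le) auto
  qed
  also have "\<dots> = ennreal (integral\<^sup>L ?P E)"
    by (intro nn_integral_eq_integral E) (auto simp: E_def)
  also have "\<dots> \<le> ennreal (4 * S\<^sup>2 * L / real N)"
    using bound by (rule ennreal_leI)
  finally show ?thesis
    by (simp add: b_def L_def)
qed

text \<open>For \<open>p = 1\<close> this is Jensen's inequality, read off from the nonnegative
  variance of the absolute value of \<open>e\<close>.\<close>

lemma (in prob_space) nn_integral_abs_power_le:
  fixes e :: "'a \<Rightarrow> real"
  assumes e: "e \<in> borel_measurable M" and "p \<in> {1, 2}" and "c \<ge> 0"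
    and sq: "(\<integral>\<^sup>+x. ennreal ((e x)\<^sup>2) \<partial>M) \<le> ennreal (c\<^sup>2)"
  shows "(\<integral>\<^sup>+x. ennreal (\<bar>e x\<bar> ^ p) \<partial>M) \<le> ennreal (c ^ p)"
proof (cases "p = 2")
  case True
  then show ?thesis using sq by simp
next
  case False
  then have p: "p = 1" using assms by auto
  \<comment> \<open>Finiteness of the bound \<open>sq\<close> gives square integrability, so the
    variance identity applies.\<close>
  have int: "integrable M (\<lambda>x. (e x)\<^sup>2)"
  proof (rule integrableI_bounded)
    show "(\<integral>\<^sup>+x. ennreal (norm ((e x)\<^sup>2)) \<partial>M) < \<infinity>"
      using le_less_trans[OF sq] by simp
  qed (use e in simp)
  have i: "integrable M e"
    using square_integrable_imp_integrable[OF e] int by simp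
  have "(\<integral>x. \<bar>e x\<bar> \<partial>M)\<^sup>2 \<le> (\<integral>x. (e x)\<^sup>2 \<partial>M)"
  proof -
    have "0 \<le> variance (\<lambda>x. \<bar>e x\<bar>)"
      by (rule variance_positive)
    also have "\<dots> = (\<integral>x. \<bar>e x\<bar>\<^sup>2 \<partial>M) - (\<integral>x. \<bar>e x\<bar> \<partial>M)\<^sup>2"
      using i int by (intro variance_eq) simp_all
    finally show ?thesis
      unfolding power2_abs by linarith
  qed
  also have "(\<integral>x. (e x)\<^sup>2 \<partial>M) \<le> c\<^sup>2"
    using sq nn_integral_eq_integral[OF int] by simp
  finally have "(\<integral>x. \<bar>e x\<bar> \<partial>M) \<le> c"
    using \<open>c \<ge> 0\<close> by (rule power2_le_imp_le)
  then show ?thesis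
    using i p by (simp add: nn_integral_eq_integral ennreal_leI)
qed

section \<open>Evidence, marginal law and link function of the model\<close>

context bayes_model
begin

sublocale prior: prob_space \<pi>0
  by (rule prior_prob)

lemma space_prior: "space \<pi>0 = X"
  using sets_eq_imp_space_eq[OF prior_sets] sets.sets_into_space[OF X_borel]
  by (auto simp: space_restrict_space)

lemma space_obs: "space (restrict_space (leb dy) Y) = Y"
  using sets.sets_into_space[OF Y_borel] by (auto simp: space_restrict_space)

text \<open>Prepares the exchange of the integrals over \<open>y\<close> and \<open>x\<close> in
  \<open>prob_space_marginal\<close>.\<close>

lemma sigma_finite_obs: "sigma_finite_measure (restrict_space (leb dy) Y)"
proof -
  interpret product_sigma_finite "\<lambda>_::nat. lborel :: real measure" ..
  have "sigma_finite_measure (leb dy)"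
    unfolding leb_def by (rule sigma_finite) simp
  then show ?thesis
    using Y_borel by (intro sigma_finite_measure_restrict_space) auto
qed

lemma likelihood_measurable:
  assumes "y \<in> Y" shows "g y \<in> borel_measurable \<pi>0"
  using measurable_Pair2[OF g_measurable, of y] assms by (simp add: space_obs)

lemma likelihood_integrable:
  assumes "y \<in> Y" shows "integrable \<pi>0 (g y)"
  using g_L2[OF assms] likelihood_measurable[OF assms]
  by (rule prior.square_integrable_imp_integrable[rotated])

text \<open>A strictly positive integrable function has positive mean under a probability measure.
  Normalisation is thus valid at every \<open>y\<close> in \<open>Y\<close>, not only almost
  everywhere.\<close>

lemma evidence_pos:
  assumes "y \<in> Y" shows "evidence \<pi>0 g y > 0"
  unfolding evidence_def
  using likelihood_integrable[OF assms] g_pos[OF _ assms]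
  by (intro prior.expectation_greater AE_I2) (auto simp: space_prior)

lemma evidence_measurable:
  "evidence \<pi>0 g \<in> borel_measurable (restrict_space (leb dy) Y)"
  unfolding evidence_def
  using g_measurable by (rule prior.borel_measurable_lebesgue_integral)

text \<open>By Tonelli the total mass is the prior mean of the integrals of \<open>g y x\<close>
  over \<open>y\<close>, each of which is 1.\<close>

lemma prob_space_marginal: "prob_space (marginal dy Y \<pi>0 g)"
proof
  let ?R = "restrict_space (leb dy) Y"
  interpret R: sigma_finite_measure ?R
    by (rule sigma_finite_obs)
  interpret pair: pair_sigma_finite ?R \<pi>0 ..
  have m: "(\<lambda>(y, x). ennreal (g y x)) \<in> borel_measurable (?R \<Otimes>\<^sub>M \<pi>0)"
    using g_measurable by (auto simp: split_beta')
  have "emeasure (marginal dy Y \<pi>0 g) (space (marginal dy Y \<pi>0 g))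
      = (\<integral>\<^sup>+y. ennreal (evidence \<pi>0 g y) \<partial>?R)"
    unfolding marginal_def using evidence_measurable
    by (subst emeasure_density) (auto intro!: nn_integral_cong)
  also have "\<dots> = (\<integral>\<^sup>+y. \<integral>\<^sup>+x. ennreal (g y x) \<partial>\<pi>0 \<partial>?R)"
    using g_pos likelihood_integrable unfolding evidence_def
    by (intro nn_integral_cong nn_integral_eq_integral[symmetric])
       (auto simp: space_obs space_prior less_imp_le)
  also have "\<dots> = (\<integral>\<^sup>+x. \<integral>\<^sup>+y. ennreal (g y x) \<partial>?R \<partial>\<pi>0)"
    using pair.Fubini'[OF m] by simp
  also have "\<dots> = (\<integral>\<^sup>+x. 1 \<partial>\<pi>0)"
  proof (rule nn_integral_cong)
    fix x assume "x \<in> space \<pi>0"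
    then have x: "x \<in> X" by (simp add: space_prior)
    \<comment> \<open>A non-integrable function would have integral 0 by default, contradicting the
      value 1.\<close>
    have "integrable ?R (\<lambda>y. g y x)"
      using g_density[OF x] not_integrable_integral_eq by fastforce
    then show "(\<integral>\<^sup>+y. ennreal (g y x) \<partial>?R) = 1"
      using g_density[OF x] g_pos[OF x]
      by (subst nn_integral_eq_integral) (auto simp: space_obs less_imp_le)
  qed
  finally show "emeasure (marginal dy Y \<pi>0 g) (space (marginal dy Y \<pi>0 g)) = 1"
    by (simp add: prior.emeasure_space_1)
qed

lemma sets_marginal: "sets (marginal dy Y \<pi>0 g) = sets (restrict_space (leb dy) Y)"
  by (simp add: marginal_def)

lemma space_marginal: "space (marginal dy Y \<pi>0 g) = Y"
  by (simp add: marginal_def space_obs)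

text \<open>Allows a constant factor to be pulled out of the integral defining \<open>K\<close>. It
  rests on measurability of parameter integrals of jointly measurable functions.\<close>

lemma L2_norm_link_measurable:
  "(\<lambda>y. L2_norm \<pi>0 (link \<pi>0 g y)) \<in> borel_measurable (marginal dy Y \<pi>0 g)"
proof -
  note [measurable] = g_measurable evidence_measurable
  have "(\<lambda>(y, x). (g y x / evidence \<pi>0 g y)\<^sup>2)
      \<in> borel_measurable (restrict_space (leb dy) Y \<Otimes>\<^sub>M \<pi>0)"
    using g_measurable unfolding split_beta' by measurable
  from prior.borel_measurable_lebesgue_integral[OF this] show ?thesis
    unfolding L2_norm_def link_def measurable_cong_sets[OF sets_marginal refl]
    by measurable
qed

text \<open>The link function is the density of the posterior with respect to the prior. These are
  the properties that \<open>importance_sampling_mean_square_error\<close> asks of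
  \<open>l\<close>.\<close>

lemma
  assumes y: "y \<in> Y"
  shows link_measurable: "link \<pi>0 g y \<in> borel_measurable \<pi>0"
    and link_pos: "x \<in> X \<Longrightarrow> link \<pi>0 g y x > 0"
    and link_L2: "integrable \<pi>0 (\<lambda>x. (link \<pi>0 g y x)\<^sup>2)"
    and link_mean: "(\<integral>x. link \<pi>0 g y x \<partial>\<pi>0) = 1"
  using likelihood_measurable[OF y] evidence_pos[OF y] g_pos[OF _ y] g_L2[OF y]
  by (auto simp: link_def[abs_def] power_divide evidence_def)

text \<open>The variance of the link function under the prior is its squared norm minus the square
  of its mean 1.\<close>

lemma L2_norm_link_ge_1:
  assumes y: "y \<in> Y" shows "L2_norm \<pi>0 (link \<pi>0 g y) \<ge> 1"
  using prior.variance_eq[of "link \<pi>0 g y"] prior.variance_positive[of "link \<pi>0 g y"]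
    link_L2[OF y] link_mean[OF y]
    prior.square_integrable_imp_integrable[OF link_measurable[OF y]]
  by (simp add: L2_norm_def)

lemma K_ge_1: "K p dy Y \<pi>0 g \<ge> 1"
proof -
  interpret E: prob_space "marginal dy Y \<pi>0 g"
    by (rule prob_space_marginal)
  show ?thesis
    unfolding K_def
    by (rule E.nn_integral_ge_const)
       (auto simp: space_marginal intro!: one_le_power L2_norm_link_ge_1)
qed

section \<open>Integrals against the posterior and the sampler; the sup norm\<close>

lemma integral_posterior:
  assumes y: "y \<in> Y" and f: "f \<in> borel_measurable \<pi>0"
  shows "(\<integral>x. f x \<partial>posterior \<pi>0 g y) = (\<integral>x. link \<pi>0 g y x * f x \<partial>\<pi>0)"
  unfolding posterior_def link_def[symmetric]
  using link_measurable[OF y] link_pos[OF y] f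
  by (subst integral_density) (auto simp: space_prior less_imp_le)

lemma integral_importance_measure:
  assumes y: "y \<in> Y" and f: "f \<in> borel_measurable \<pi>0"
    and xs: "xs \<in> space (Pi\<^sub>M {..<N} (\<lambda>_. \<pi>0))"
  shows "(\<integral>x. f x \<partial>importance_measure \<pi>0 g N y xs)
    = (\<Sum>i<N. link \<pi>0 g y (xs i) / (\<Sum>j<N. link \<pi>0 g y (xs j)) * f (xs i))"
proof -
  have X: "xs i \<in> X" if "i < N" for i
    using xs that by (auto simp: space_PiM space_prior)
  have nonneg: "weight g N y xs i \<ge> 0" if "i < N" for i
    unfolding weight_def using g_pos[OF X y] that
    by (intro divide_nonneg_nonneg sum_nonneg) (auto intro: less_imp_le)
  \<comment> \<open>The evidence cancels between numerator and denominator.\<close>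
  have weight: "weight g N y xs i = link \<pi>0 g y (xs i) / (\<Sum>j<N. link \<pi>0 g y (xs j))" for i
    using evidence_pos[OF y] by (simp add: weight_def link_def sum_divide_distrib[symmetric])
  have m: "xs \<in> measurable (point_measure {..<N} (\<lambda>i. ennreal (weight g N y xs i))) \<pi>0"
    using X by (auto simp: point_measure_def measurable_def space_density space_prior)
  show ?thesis
    unfolding importance_measure_def integral_distr[OF m f]
    using nonneg by (subst lebesgue_integral_point_measure_finite) (auto simp: weight)
qed

text \<open>A real \<open>SUP\<close> is known to be an upper bound only for a set bounded above;
  boundedness of \<open>f\<close> supplies this.\<close>

lemma abs_le_sup_norm:
  assumes "f \<in> bounded_measurable \<pi>0" and "x \<in> X"
  shows "\<bar>f x\<bar> \<le> sup_norm X f"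
proof -
  have "bdd_above ((\<lambda>x. \<bar>f x\<bar>) ` X)"
    using assms(1) by (auto simp: bounded_measurable_def bounded_iff space_prior bdd_above_def)
  then show ?thesis
    unfolding sup_norm_def using assms(2) by (rule cSUP_upper[rotated])
qed

text \<open>The prior has mass 1, so \<open>X\<close> is nonempty and the supremum dominates some
  absolute value.\<close>

lemma sup_norm_nonneg:
  assumes "f \<in> bounded_measurable \<pi>0"
  shows "sup_norm X f \<ge> 0"
  using abs_le_sup_norm[OF assms] prior.not_empty space_prior
  by (metis abs_ge_zero all_not_in_conv order_trans)

section \<open>The error given the observation, then averaged over it\<close>

lemma conditional_error_le:
  assumes p: "p \<in> {1, 2}" and f: "f \<in> bounded_measurable \<pi>0" and N: "N \<ge> 1" and y: "y \<in> Y"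
  shows "(\<integral>\<^sup>+xs. ennreal (\<bar>(\<integral>x. f x \<partial>posterior \<pi>0 g y)
        - (\<integral>x. f x \<partial>importance_measure \<pi>0 g N y xs)\<bar> ^ p) \<partial>Pi\<^sub>M {..<N} (\<lambda>_. \<pi>0))
    \<le> ennreal ((2 * sup_norm X f / sqrt (real N)) ^ p) * ennreal (L2_norm \<pi>0 (link \<pi>0 g y) ^ p)"
proof -
  let ?P = "Pi\<^sub>M {..<N} (\<lambda>_. \<pi>0)"
  interpret P: prob_space ?P
    by (intro prob_space_PiM prior_prob)
  define l where "l = link \<pi>0 g y"
  define S where "S = sup_norm X f"
  \<comment> \<open>\<open>c\<close> is the bound on the conditional root mean square error, the
    square root of the bound on the mean square error.\<close>
  define c where "c = 2 * S / sqrt (real N) * L2_norm \<pi>0 l"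
  have [measurable]: "f \<in> borel_measurable \<pi>0" "l \<in> borel_measurable \<pi>0"
    using f link_measurable[OF y] by (auto simp: bounded_measurable_def l_def)
  have c: "c \<ge> 0"
    using sup_norm_nonneg[OF f] by (auto simp: c_def S_def L2_norm_def)
  have c2: "c\<^sup>2 = 4 * S\<^sup>2 * (\<integral>x. (l x)\<^sup>2 \<partial>\<pi>0) / real N"
    by (simp add: c_def L2_norm_def power_mult_distrib power_divide)
  define e where "e xs = (\<integral>x. l x * f x \<partial>\<pi>0)
      - (\<Sum>i<N. l (xs i) / (\<Sum>j<N. l (xs j)) * f (xs i))" for xs
  have "(\<integral>\<^sup>+xs. ennreal ((e xs)\<^sup>2) \<partial>?P) \<le> ennreal (c\<^sup>2)"
    unfolding e_def c2
    using link_measurable[OF y] link_L2[OF y] link_mean[OF y] link_pos[OF y] abs_le_sup_norm[OF f] N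
    by (intro prior.importance_sampling_mean_square_error) (auto simp: l_def S_def space_prior)
  moreover have "e \<in> borel_measurable ?P"
    unfolding e_def by measurable
  ultimately have "(\<integral>\<^sup>+xs. ennreal (\<bar>e xs\<bar> ^ p) \<partial>?P) \<le> ennreal (c ^ p)"
    using p c by (intro P.nn_integral_abs_power_le)
  \<comment> \<open>With the norm split off as a factor, integration over \<open>y\<close> produces
    \<open>K\<close>.\<close>
  moreover have "ennreal (c ^ p) = ennreal ((2 * S / sqrt (real N)) ^ p) * ennreal (L2_norm \<pi>0 l ^ p)"
    unfolding c_def power_mult_distrib
    using sup_norm_nonneg[OF f] by (intro ennreal_mult) (auto simp: S_def L2_norm_def)
  moreover have "(\<integral>\<^sup>+xs. ennreal (\<bar>e xs\<bar> ^ p) \<partial>?P) = (\<integral>\<^sup>+xs. ennreal (\<bar>(\<integral>x. f x \<partial>posterior \<pi>0 g y)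
        - (\<integral>x. f x \<partial>importance_measure \<pi>0 g N y xs)\<bar> ^ p) \<partial>?P)"
    by (intro nn_integral_cong)
       (simp add: e_def l_def integral_posterior[OF y] integral_importance_measure[OF y])
  ultimately show ?thesis
    by (simp add: l_def S_def)
qed

lemma Lp_error_le:
  assumes p: "p \<in> {1, 2}" and K: "K p dy Y \<pi>0 g \<le> ennreal k"
    and f: "f \<in> bounded_measurable \<pi>0" and N: "N \<ge> 1"
  shows "Lp_error p dy Y \<pi>0 g N f \<le> 2 * k * sup_norm X f / sqrt (real N)"
proof -
  let ?P = "Pi\<^sub>M {..<N} (\<lambda>_. \<pi>0)" and ?E = "marginal dy Y \<pi>0 g"
  interpret P: prob_space ?P
    by (intro prob_space_PiM prior_prob)
  define e where "e = (\<lambda>(y, xs). \<bar>(\<integral>x. f x \<partial>posterior \<pi>0 g y)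
      - (\<integral>x. f x \<partial>importance_measure \<pi>0 g N y xs)\<bar> ^ p)"
  define a where "a = 2 * sup_norm X f / sqrt (real N)"
  \<comment> \<open>\<open>ennreal\<close> sends negative reals to 0, so the sign of
    \<open>k\<close> is read off from the lower bound 1 on \<open>K\<close>.\<close>
  have k: "k \<ge> 1"
    using order_trans[OF K_ge_1 K] by simp
  have a: "a \<ge> 0"
    using sup_norm_nonneg[OF f] by (simp add: a_def)
  have e: "e z \<ge> 0" for z
    by (simp add: e_def split_beta)
  have "integral\<^sup>L (?E \<Otimes>\<^sub>M ?P) e \<le> a ^ p * k"
  \<comment> \<open>Integrability brings the joint measurability of \<open>e\<close> that the
    passage to iterated integrals requires.\<close>
  proof (cases "integrable (?E \<Otimes>\<^sub>M ?P) e")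
    case True
    have "ennreal (integral\<^sup>L (?E \<Otimes>\<^sub>M ?P) e) = (\<integral>\<^sup>+z. ennreal (e z) \<partial>(?E \<Otimes>\<^sub>M ?P))"
      using True e by (intro nn_integral_eq_integral[symmetric]) auto
    also have "\<dots> = (\<integral>\<^sup>+y. \<integral>\<^sup>+xs. ennreal (e (y, xs)) \<partial>?P \<partial>?E)"
      using True by (intro P.nn_integral_fst[symmetric]) auto
    also have "\<dots> \<le> (\<integral>\<^sup>+y. ennreal (a ^ p) * ennreal (L2_norm \<pi>0 (link \<pi>0 g y) ^ p) \<partial>?E)"
      unfolding e_def a_def prod.case
      by (intro nn_integral_mono conditional_error_le p f N) (simp add: space_marginal)
    also have "\<dots> = ennreal (a ^ p) * K p dy Y \<pi>0 g"
      unfolding K_def using L2_norm_link_measurable by (intro nn_integral_cmult) measurable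
    also have "\<dots> \<le> ennreal (a ^ p * k)"
      using mult_left_mono[OF K, of "ennreal (a ^ p)"] a k by (simp add: ennreal_mult)
    finally show ?thesis
      using a k by (simp add: ennreal_le_iff)
  next
    case False  \<comment> \<open>the Bochner integral is then 0\<close>
    then show ?thesis
      using a k by (simp add: not_integrable_integral_eq)
  qed
  \<comment> \<open>Since \<open>k \<ge> 1\<close>, raising it to the power \<open>p\<close> only
    weakens the bound and makes it a perfect \<open>p\<close>-th power, whose root is linear in
    \<open>k\<close>.\<close>
  also have "\<dots> \<le> a ^ p * k ^ p"
    using p k a by (intro mult_left_mono self_le_power) auto
  finally have "integral\<^sup>L (?E \<Otimes>\<^sub>M ?P) e \<le> (a * k) ^ p"
    by (simp add: power_mult_distrib)
  then have "Lp_error p dy Y \<pi>0 g N f \<le> ((a * k) ^ p) powr (1 / real p)"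
    unfolding Lp_error_def e_def using e by (intro powr_mono2) (auto simp: e_def)
  also have "\<dots> = a * k"
    using p a k by (auto simp: powr_half_sqrt)
  finally show ?thesis
    by (simp add: a_def mult_ac)
qed

end

theorem theorem3p3:
  fixes p :: nat
  assumes "p \<in> {1, 2}"
  shows "\<exists>B::real. \<forall>(dy::nat) (Y :: (nat \<Rightarrow> real) set)
      (X :: nat \<Rightarrow> (nat \<Rightarrow> real) set) (\<pi>0 :: nat \<Rightarrow> (nat \<Rightarrow> real) measure)
      (g :: nat \<Rightarrow> (nat \<Rightarrow> real) \<Rightarrow> (nat \<Rightarrow> real) \<Rightarrow> real) (n::nat) (P :: real poly).
    dy \<ge> 1 \<and>
    (\<forall>dx\<ge>1. bayes_model dx dy (X dx) Y (\<pi>0 dx) (g dx)) \<and>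
    (\<forall>dx\<ge>1. link_Bochner_integrable p dy Y (\<pi>0 dx) (g dx)) \<and>
    degree P = n \<and>
    (\<forall>dx\<ge>1. K p dy Y (\<pi>0 dx) (g dx) \<le> ennreal (poly P (real dx)))
    \<longrightarrow>
    (\<forall>dx\<ge>1. \<forall>f \<in> bounded_measurable (\<pi>0 dx). \<forall>N\<ge>1.
      Lp_error p dy Y (\<pi>0 dx) (g dx) N f
        \<le> B * poly P (real dx) * sup_norm (X dx) f / sqrt (real N))"
proof (intro exI[of _ 2] allI impI ballI, elim conjE)
  fix dy Y X \<pi>0 g n P dx f N
  assume "dx \<ge> (1::nat)" and N: "N \<ge> (1::nat)"
    and f: "f \<in> bounded_measurable (\<pi>0 dx :: (nat \<Rightarrow> real) measure)"
    and "\<forall>dx\<ge>1. bayes_model dx dy (X dx) Y (\<pi>0 dx) (g dx)"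
    and "\<forall>dx\<ge>1. K p dy Y (\<pi>0 dx) (g dx) \<le> ennreal (poly P (real dx))"
  then have model: "bayes_model dx dy (X dx) Y (\<pi>0 dx) (g dx)"
    and K: "K p dy Y (\<pi>0 dx) (g dx) \<le> ennreal (poly P (real dx))"
    by auto
  \<comment> \<open>Each dimension is treated on its own, with \<open>k\<close> the value of the
    polynomial at \<open>dx\<close>; the constant 2 is the same for all of them.\<close>
  show "Lp_error p dy Y (\<pi>0 dx) (g dx) N f
      \<le> 2 * poly P (real dx) * sup_norm (X dx) f / sqrt (real N)"
    by (rule bayes_model.Lp_error_le[OF model assms K f N])
qed

end
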